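(* Let $\alpha\in\mathbb{R}$. There exists a sequence of normalized functions $\{g_n\}_{n=0}^\infty\subset D_\alpha\setminus\{0\}$ (i.e. $\|g_n\|_\alpha=1$ for all $n$) such that, if $M_n$ denotes the $2\times 2$ matrix of the linear system determining the optimal polynomial approximant of degree $1$ to $1/g_n$, then $$\|M_n^{-1}\|_F\to\infty\quad\text{as } n\to\infty.$$
   Context: $\mathbb{D}$ is the open unit disc in $\mathbb{C}$. For $\alpha\in\mathbb{R}$, the Dirichlet-type space $D_\alpha$ is the Hilbert space of all analytic functions $f(z)=\sum_{k=0}^\infty a_kz^k$ on $\mathbb{D}$ with $\|f\|_\alpha^2:=\sum_{k=0}^\infty |a_k|^2(k+1)^\alpha<\infty$, with inner product $\langle f,g\rangle_\alpha=\sum_{k=0}^\infty a_k\overline{b_k}(k+1)^\alpha$ for $g(z)=\sum_{k=0}^\infty b_kz^k$. $S$ is the shift operator, $Sf(z)=zf(z)$. For $g\in D_\alpha\setminus\{0\}$, the optimal polynomial approximant of degree $1$ to $1/g$ is the unique polynomial $p$ of degree at most $1$ minimizing $\|pg-1\|_\alpha$. Its coefficient vector $c\in\mathbb{C}^2$ is the unique solution of the linear system $Mc=b$, where $M=(m_{j,k})_{j,k=0}^1$ is the (invertible) $2\times 2$ matrix with entries $m_{j,k}=\langle S^kg,S^jg\rangle_\alpha$ and $b=(b_0,b_1)$ with $b_k=\langle 1,S^kg\rangle_\alpha$. $\|\cdot\|_F$ is the Frobenius norm of matrices. *)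

theory Defs
  imports "HOL-Complex_Analysis.Complex_Analysis"
begin

text \<open>
  Elements of \<open>D\<^sub>\<alpha>\<close> are represented by functions on all of \<open>\<complex>\<close> that are holomorphic
  on the open unit disc; values outside the disc are irrelevant, so two representatives
  are the same element of \<open>D\<^sub>\<alpha>\<close> iff they agree on \<open>ball 0 1\<close>.
\<close>

definition taylor_coeff :: "(complex \<Rightarrow> complex) \<Rightarrow> nat \<Rightarrow> complex" where
  "taylor_coeff f k = fps_nth (fps_expansion f 0) k"

definition dirichlet_space :: "real \<Rightarrow> (complex \<Rightarrow> complex) set" where
  "dirichlet_space \<alpha> = {f. f holomorphic_on ball 0 1 \<and>
     summable (\<lambda>k. (cmod (taylor_coeff f k))\<^sup>2 * (real k + 1) powr \<alpha>)}"

definition dirichlet_norm :: "real \<Rightarrow> (complex \<Rightarrow> complex) \<Rightarrow> real" where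
  "dirichlet_norm \<alpha> f = sqrt (\<Sum>k. (cmod (taylor_coeff f k))\<^sup>2 * (real k + 1) powr \<alpha>)"

definition dirichlet_inner ::
    "real \<Rightarrow> (complex \<Rightarrow> complex) \<Rightarrow> (complex \<Rightarrow> complex) \<Rightarrow> complex" where
  "dirichlet_inner \<alpha> f g =
     (\<Sum>k. taylor_coeff f k * cnj (taylor_coeff g k) * complex_of_real ((real k + 1) powr \<alpha>))"

definition shift :: "(complex \<Rightarrow> complex) \<Rightarrow> complex \<Rightarrow> complex" where
  "shift f = (\<lambda>z. z * f z)"

definition gram_entry :: "real \<Rightarrow> (complex \<Rightarrow> complex) \<Rightarrow> nat \<Rightarrow> nat \<Rightarrow> complex" where
  "gram_entry \<alpha> g j k = dirichlet_inner \<alpha> ((shift ^^ k) g) ((shift ^^ j) g)"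

text \<open>
  The matrix of the linear system for the optimal polynomial approximant of degree 1 to \<open>1/g\<close>.
  Rows and columns \<open>0, 1\<close> of the mathematical matrix are stored at the indices \<open>1, 2\<close>
  of type \<open>2\<close>.
\<close>
definition opa_matrix :: "real \<Rightarrow> (complex \<Rightarrow> complex) \<Rightarrow> complex^2^2" where
  "opa_matrix \<alpha> g = vector
     [vector [gram_entry \<alpha> g 0 0, gram_entry \<alpha> g 0 1],
      vector [gram_entry \<alpha> g 1 0, gram_entry \<alpha> g 1 1]]"

definition frobenius_norm :: "complex^'n^'m \<Rightarrow> real" where
  "frobenius_norm A = sqrt (\<Sum>i\<in>UNIV. \<Sum>j\<in>UNIV. (cmod (A $ i $ j))\<^sup>2)"

end

theory Submission
  imports Defs "HOL-Real_Asymp.Real_Asymp"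
begin

text \<open>
  For \<open>\<parallel>g\<parallel> = 1\<close> the lower right entry of \<open>M\<^sup>-\<^sup>1\<close> is \<open>1 / det M\<close> with
  \<open>det M = \<parallel>S g\<parallel>\<^sup>2 - \<bar>\<langle>S g, g\<rangle>\<bar>\<^sup>2\<close>, so it suffices to find unit vectors \<open>g\<close> that are almost
  eigenvectors of \<open>S\<close>. Spreading the mass of \<open>g\<close> evenly over the orthonormal basis vectors
  \<open>z\<^sup>k / \<parallel>z\<^sup>k\<parallel>\<close>, \<open>k \<le> n\<close>, does this: with \<open>r\<^sub>k = ((k + 2) / (k + 1))\<^sup>\<alpha>\<^sup>/\<^sup>2\<close>, the numbers
  \<open>\<parallel>S g\<parallel>\<^sup>2\<close> and \<open>\<langle>S g, g\<rangle>\<close> are essentially the Cesaro means of \<open>r\<^sub>k\<^sup>2\<close> and \<open>r\<^sub>k\<close>, and both tend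
  to \<open>1\<close>. The Cauchy-Schwarz inequality gives \<open>det M > 0\<close>.
\<close>

text \<open>Past some \<open>K\<close> each term is below \<open>e / 2\<close>, so these terms
  contribute at most \<open>e / 2\<close> to the mean; the first \<open>K\<close> terms have a fixed
  total \<open>C\<close>, and \<open>C / n\<close> tends to 0.\<close>

lemma cesaro_mean_tendsto_0:
  fixes x :: "nat \<Rightarrow> real"
  assumes "x \<longlonglongrightarrow> 0"
  shows "(\<lambda>n. (\<Sum>k<n. x k) / real n) \<longlonglongrightarrow> 0"
proof (rule LIMSEQ_I)
  fix e :: real
  assume "e > 0"
  then obtain K where K: "\<And>k. k \<ge> K \<Longrightarrow> \<bar>x k\<bar> < e / 2"
    using LIMSEQ_D[OF assms, of "e / 2"] by auto
  define C where "C = (\<Sum>k<K. \<bar>x k\<bar>)"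
  have "(\<lambda>n. C / real n) \<longlonglongrightarrow> 0"
    by (rule lim_const_over_n)
  then obtain N where N: "\<And>n. n \<ge> N \<Longrightarrow> \<bar>C / real n\<bar> < e / 2"
    using LIMSEQ_D[of "\<lambda>n. C / real n" 0 "e / 2"] \<open>e > 0\<close> by auto
  have "\<bar>(\<Sum>k<n. x k) / real n\<bar> < e" if n: "n \<ge> max (Suc K) N" for n
  proof -
    have "\<bar>\<Sum>k<n. x k\<bar> \<le> (\<Sum>k<n. \<bar>x k\<bar>)"
      by (rule sum_abs)
    also have "(\<Sum>k<n. \<bar>x k\<bar>) = C + (\<Sum>k\<in>{K..<n}. \<bar>x k\<bar>)"
      unfolding C_def lessThan_atLeast0 using n by (intro sum.atLeastLessThan_concat[symmetric]) auto
    also have "(\<Sum>k\<in>{K..<n}. \<bar>x k\<bar>) \<le> real (n - K) * (e / 2)"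
      using sum_bounded_above[of "{K..<n}" "\<lambda>k. \<bar>x k\<bar>" "e / 2"] K by (force intro: less_imp_le)
    also have "\<dots> \<le> real n * (e / 2)"
      using \<open>e > 0\<close> by (intro mult_right_mono) auto
    finally have "\<bar>(\<Sum>k<n. x k) / real n\<bar> \<le> C / real n + e / 2"
      using n by (simp add: field_simps)
    with N[of n] n show ?thesis by linarith
  qed
  then show "\<exists>M. \<forall>n\<ge>M. norm ((\<Sum>k<n. x k) / real n - 0) < e"
    by (intro exI[of _ "max (Suc K) N"]) auto
qed

lemma cesaro_mean_tendsto:
  fixes x :: "nat \<Rightarrow> real"
  assumes "x \<longlonglongrightarrow> L"
  shows "(\<lambda>n. (\<Sum>k<n. x k) / real n) \<longlonglongrightarrow> L"
proof -
  have "(\<lambda>n. (\<Sum>k<n. x k - L) / real n) \<longlonglongrightarrow> 0"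
    using assms by (intro cesaro_mean_tendsto_0) (simp add: LIM_zero)
  \<comment> \<open>Only eventually: at \<open>n = 0\<close> division by zero makes the left side 0
    and the right side \<open>- L\<close>.\<close>
  moreover have "\<forall>\<^sub>F n in sequentially. (\<Sum>k<n. x k - L) / real n = (\<Sum>k<n. x k) / real n - L"
    using eventually_gt_at_top[of 0]
    by eventually_elim (simp add: sum_subtractf diff_divide_distrib)
  ultimately have "(\<lambda>n. (\<Sum>k<n. x k) / real n - L) \<longlonglongrightarrow> 0"
    by (simp cong: tendsto_cong)
  then show ?thesis
    by (rule LIM_zero_cancel)
qed

text \<open>By Cramer's rule the lower right entry of the inverse is
  \<open>A $ 1 $ 1 / det A\<close>, and the Frobenius norm dominates the modulus of every
  entry.\<close>

lemma frobenius_norm_matrix_inv_ge: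
  fixes A :: "complex^2^2"
  assumes "det A \<noteq> 0"
  shows "frobenius_norm (matrix_inv A) \<ge> cmod (A $ 1 $ 1) / cmod (det A)"
proof -
  define B where "B = matrix_inv A"
  \<comment> \<open>\<open>matrix_inv\<close> is a choice of a two-sided inverse; the nonzero
    determinant guarantees that one exists.\<close>
  have "A ** B = mat 1"
    using assms someI_ex[of "\<lambda>B. A ** B = mat 1 \<and> B ** A = mat 1"]
    unfolding B_def matrix_inv_def by (simp add: invertible_det_nz[symmetric] invertible_def)
  then have "(A ** B) $ 1 $ 2 = 0" "(A ** B) $ 2 $ 2 = 1"
    by (simp_all add: mat_def)
  then have "A$1$1 * B$1$2 + A$1$2 * B$2$2 = 0" "A$2$1 * B$1$2 + A$2$2 * B$2$2 = 1"
    by (simp_all add: matrix_matrix_mult_def sum_2)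
  then have "det A * B$2$2 = A$1$1"
    unfolding det_2 by algebra
  then have "B$2$2 = A$1$1 / det A"
    using assms by (simp add: field_simps)
  then have "cmod (A $ 1 $ 1) / cmod (det A) = sqrt ((cmod (B$2$2))\<^sup>2)"
    by (simp add: norm_divide)
  also have "\<dots> \<le> frobenius_norm B"
    unfolding frobenius_norm_def sum_2 by (intro real_sqrt_le_mono) simp
  finally show ?thesis
    unfolding B_def .
qed

lemma taylor_coeff_polynomial:
  "taylor_coeff (\<lambda>z. \<Sum>k<N. a k * z ^ k) m = (if m < N then a m else 0)"
proof -
  have "(\<lambda>z. \<Sum>k<N. a k * z ^ k) has_fps_expansion (\<Sum>k<N. fps_const (a k) * fps_X ^ k)"
    by (intro fps_expansion_intros)
  then have "taylor_coeff (\<lambda>z. \<Sum>k<N. a k * z ^ k) m = fps_nth (\<Sum>k<N. fps_const (a k) * fps_X ^ k) m"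
    unfolding taylor_coeff_def by (simp only: fps_expansion_eqI)
  also have "\<dots> = (\<Sum>k<N. if k = m then a k else 0)"
    unfolding fps_sum_nth by (intro sum.cong) auto
  also have "\<dots> = (if m < N then a m else 0)"
    by simp
  finally show ?thesis .
qed

lemma polynomial_in_dirichlet_space: "(\<lambda>z. \<Sum>k<N. a k * z ^ k) \<in> dirichlet_space \<alpha>"
  unfolding dirichlet_space_def
  by (auto simp: taylor_coeff_polynomial split: if_splits
      intro!: holomorphic_intros summable_finite[of "{..<N}"])

lemma dirichlet_norm_polynomial:
  "dirichlet_norm \<alpha> (\<lambda>z. \<Sum>k<N. a k * z ^ k) =
     sqrt (\<Sum>k<N. (cmod (a k))\<^sup>2 * (real k + 1) powr \<alpha>)"
  unfolding dirichlet_norm_def taylor_coeff_polynomial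
  by (subst suminf_finite[of "{..<N}"]) auto

lemma dirichlet_inner_polynomial:
  "dirichlet_inner \<alpha> (\<lambda>z. \<Sum>k<M. a k * z ^ k) (\<lambda>z. \<Sum>k<N. b k * z ^ k) =
     (\<Sum>k<min M N. a k * cnj (b k) * complex_of_real ((real k + 1) powr \<alpha>))"
  unfolding dirichlet_inner_def taylor_coeff_polynomial
  by (subst suminf_finite[of "{..<min M N}"]) auto

text \<open>Keeps the shifted function in the same polynomial form, so that the formula for the
  inner product applies to it as well.\<close>

lemma shift_polynomial:
  "shift (\<lambda>z. \<Sum>k<N. a k * z ^ k) = (\<lambda>z. \<Sum>k<Suc N. (case k of 0 \<Rightarrow> 0 | Suc j \<Rightarrow> a j) * z ^ k)"
  unfolding shift_def sum.lessThan_Suc_shift by (simp add: sum_distrib_left mult_ac)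

text \<open>The shift moves \<open>a k\<close> to index \<open>k + 1\<close>, where the weight is
  \<open>(k + 2) powr \<alpha>\<close>. Off the diagonal, \<open>a k\<close> meets
  \<open>a (Suc k)\<close>, which leaves only \<open>n\<close> products; real coefficients make both
  of these entries equal.\<close>

lemma opa_matrix_polynomial:
  fixes a :: "nat \<Rightarrow> real" and n :: nat and \<alpha> :: real
  defines "g \<equiv> (\<lambda>z. \<Sum>k<Suc n. complex_of_real (a k) * z ^ k)"
  defines "s \<equiv> (\<Sum>k<n. a k * a (Suc k) * (real k + 2) powr \<alpha>)"
  shows "opa_matrix \<alpha> g = vector
    [vector [of_real (\<Sum>k<Suc n. (a k)\<^sup>2 * (real k + 1) powr \<alpha>), of_real s],
     vector [of_real s, of_real (\<Sum>k<Suc n. (a k)\<^sup>2 * (real k + 2) powr \<alpha>)]]"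
proof -
  have "gram_entry \<alpha> g 0 0 = of_real (\<Sum>k<Suc n. (a k)\<^sup>2 * (real k + 1) powr \<alpha>)"
    unfolding gram_entry_def g_def
    by (simp add: dirichlet_inner_polynomial power2_eq_square del: sum.lessThan_Suc)
  moreover have "gram_entry \<alpha> g 0 1 = of_real s"
    unfolding gram_entry_def g_def s_def
    by (simp add: shift_polynomial dirichlet_inner_polynomial del: sum.lessThan_Suc)
      (simp add: sum.lessThan_Suc_shift[where n = n] add_ac del: sum.lessThan_Suc)
  moreover have "gram_entry \<alpha> g 1 0 = of_real s"
    unfolding gram_entry_def g_def s_def
    by (simp add: shift_polynomial dirichlet_inner_polynomial del: sum.lessThan_Suc)
      (simp add: sum.lessThan_Suc_shift[where n = n] mult_ac add_ac del: sum.lessThan_Suc)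
  moreover have "gram_entry \<alpha> g 1 1 = of_real (\<Sum>k<Suc n. (a k)\<^sup>2 * (real k + 2) powr \<alpha>)"
    unfolding gram_entry_def g_def
    by (simp add: shift_polynomial dirichlet_inner_polynomial del: sum.lessThan_Suc)
      (simp add: sum.lessThan_Suc_shift[where n = "Suc n"] power2_eq_square add_ac
        del: sum.lessThan_Suc)
  ultimately show ?thesis
    unfolding opa_matrix_def by simp
qed

theorem proposition4p5:
  fixes \<alpha> :: real
  shows "\<exists>g :: nat \<Rightarrow> complex \<Rightarrow> complex.
    (\<forall>n. g n \<in> dirichlet_space \<alpha> \<and> (\<exists>z\<in>ball 0 1. g n z \<noteq> 0) \<and> dirichlet_norm \<alpha> (g n) = 1) \<and>
    filterlim (\<lambda>n. frobenius_norm (matrix_inv (opa_matrix \<alpha> (g n)))) at_top sequentially"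
proof -
  \<comment> \<open>\<open>w k\<close> is the reciprocal of the norm of \<open>z ^ k\<close>.
    Dividing by \<open>sqrt (n + 1)\<close> gives each of the \<open>n + 1\<close> basis vectors in
    \<open>g n\<close> the squared mass \<open>1 / (n + 1)\<close>.\<close>
  define w where "w k = (real k + 1) powr (- \<alpha> / 2)" for k
  define a where "a n k = w k / sqrt (real (Suc n))" for n k
  define g where "g n = (\<lambda>z. \<Sum>k<Suc n. complex_of_real (a n k) * z ^ k)" for n
  define r where "r k = ((real k + 2) / (real k + 1)) powr (\<alpha> / 2)" for k
  define t where "t n = (\<Sum>k<Suc n. (r k)\<^sup>2) / real (Suc n)" for n
  \<comment> \<open>One term short of a mean: the shift sends the top monomial of \<open>g n\<close>
    to \<open>z ^ (n + 1)\<close>, which is orthogonal to \<open>g n\<close>.\<close>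
  define s where "s n = (\<Sum>k<n. r k) / real (Suc n)" for n
  have r_pos: "r k > 0" for k
    unfolding r_def by simp
  have w_sq: "(w k)\<^sup>2 = (real k + 1) powr - \<alpha>" for k
    unfolding w_def by (simp add: power2_eq_square flip: powr_add)
  have w1: "(w k)\<^sup>2 * (real k + 1) powr \<alpha> = 1" for k
    unfolding w_sq by (simp flip: powr_add)
  have w2: "(w k)\<^sup>2 * (real k + 2) powr \<alpha> = (r k)\<^sup>2" for k
    unfolding w_sq r_def by (simp add: powr_divide powr_minus_divide power2_eq_square flip: powr_add)
  have w3: "w k * w (Suc k) * (real k + 2) powr \<alpha> = r k" for k
  proof -
    have "(real k + 2) powr (- \<alpha> / 2) * (real k + 2) powr \<alpha> = (real k + 2) powr (\<alpha> / 2)"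
      by (simp flip: powr_add)
    then have "w (Suc k) * (real k + 2) powr \<alpha> = (real k + 2) powr (\<alpha> / 2)"
      unfolding w_def by (simp add: add_ac)
    then show ?thesis
      unfolding mult.assoc by (simp add: w_def[of k] r_def powr_divide powr_minus_divide)
  qed
  have a1: "(\<Sum>k<Suc n. (a n k)\<^sup>2 * (real k + 1) powr \<alpha>) = 1" for n
    unfolding a_def by (simp add: power_divide w1 del: sum.lessThan_Suc of_nat_Suc)
  have a2: "(\<Sum>k<Suc n. (a n k)\<^sup>2 * (real k + 2) powr \<alpha>) = t n" for n
    unfolding a_def t_def
    by (simp add: power_divide w2 sum_divide_distrib del: sum.lessThan_Suc of_nat_Suc)
  have a3: "(\<Sum>k<n. a n k * a n (Suc k) * (real k + 2) powr \<alpha>) = s n" for n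
    unfolding a_def s_def by (simp add: w3 sum_divide_distrib del: of_nat_Suc)
  have M: "opa_matrix \<alpha> (g n) = vector [vector [1, of_real (s n)], vector [of_real (s n), of_real (t n)]]"
    for n
    unfolding g_def opa_matrix_polynomial a1 a2 a3 by simp
  then have det: "det (opa_matrix \<alpha> (g n)) = of_real (t n - (s n)\<^sup>2)" for n
    by (simp add: det_2 power2_eq_square)
  have det_pos: "t n - (s n)\<^sup>2 > 0" for n
  proof -
    have "(\<Sum>k<n. r k)\<^sup>2 \<le> real n * (\<Sum>k<n. (r k)\<^sup>2)"
      using sum_squared_le_sum_of_squares[of r "{..<n}"] by (simp add: mult.commute)
    also have "\<dots> \<le> real n * (\<Sum>k<Suc n. (r k)\<^sup>2)"
      by (intro mult_left_mono) auto
    \<comment> \<open>Strictness comes from this missing term: \<open>n\<close> in place of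
      \<open>n + 1\<close>, times a positive sum.\<close>
    also have "\<dots> < real (Suc n) * (\<Sum>k<Suc n. (r k)\<^sup>2)"
      by (intro mult_strict_right_mono sum_pos zero_less_power r_pos) auto
    finally have "(\<Sum>k<n. r k)\<^sup>2 / (real (Suc n))\<^sup>2
        < real (Suc n) * (\<Sum>k<Suc n. (r k)\<^sup>2) / (real (Suc n))\<^sup>2"
      by (intro divide_strict_right_mono) auto
    then show ?thesis
      unfolding s_def t_def by (simp add: power_divide power2_eq_square del: sum.lessThan_Suc of_nat_Suc)
  qed
  have r_lim: "r \<longlonglongrightarrow> 1"
    unfolding r_def by real_asymp
  have "(\<lambda>k. (r k)\<^sup>2) \<longlonglongrightarrow> 1"
    using tendsto_power[OF r_lim, of 2] by simp
  then have t_lim: "t \<longlonglongrightarrow> 1"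
    unfolding t_def by (rule LIMSEQ_Suc[OF cesaro_mean_tendsto])
  \<comment> \<open>\<open>s n\<close> is the full mean minus its last term, which vanishes in the
    limit because \<open>r\<close> converges.\<close>
  have "(\<lambda>n. (\<Sum>k<Suc n. r k) / real (Suc n) - r n / real (Suc n)) \<longlonglongrightarrow> 1 - 0"
    by (intro tendsto_diff LIMSEQ_Suc[OF cesaro_mean_tendsto[OF r_lim]]
        real_tendsto_divide_at_top[OF r_lim] filterlim_compose[OF filterlim_real_sequentially filterlim_Suc])
  then have s_lim: "s \<longlonglongrightarrow> 1"
    unfolding s_def by (simp add: add_divide_distrib)
  have "(\<lambda>n. t n - (s n)\<^sup>2) \<longlonglongrightarrow> 1 - 1\<^sup>2"
    by (intro tendsto_intros t_lim s_lim)
  then have "filterlim (\<lambda>n. inverse (t n - (s n)\<^sup>2)) at_top sequentially"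
    using det_pos by (intro filterlim_inverse_at_top) simp_all
  moreover have "inverse (t n - (s n)\<^sup>2) \<le> frobenius_norm (matrix_inv (opa_matrix \<alpha> (g n)))" for n
  proof -
    have "det (opa_matrix \<alpha> (g n)) \<noteq> 0"
      unfolding det of_real_eq_0_iff using det_pos[of n] by linarith
    from frobenius_norm_matrix_inv_ge[OF this] show ?thesis
      unfolding det norm_of_real using det_pos[of n] by (simp add: M inverse_eq_divide)
  qed
  ultimately have "filterlim (\<lambda>n. frobenius_norm (matrix_inv (opa_matrix \<alpha> (g n)))) at_top sequentially"
    by (blast intro: filterlim_at_top_mono always_eventually)
  moreover have "g n \<in> dirichlet_space \<alpha>" for n
    unfolding g_def by (rule polynomial_in_dirichlet_space)
  moreover have "dirichlet_norm \<alpha> (g n) = 1" for n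
    unfolding g_def dirichlet_norm_polynomial norm_of_real power2_abs a1 by simp
  moreover have "\<exists>z\<in>ball 0 1. g n z \<noteq> 0" for n
  proof
    \<comment> \<open>The value at 0 is the constant coefficient \<open>a n 0\<close>, which is
      positive.\<close>
    show "g n 0 \<noteq> 0"
      unfolding g_def sum.lessThan_Suc_shift by (simp add: a_def w_def)
  qed simp
  ultimately show ?thesis
    by blast
qed

end
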